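(* Let $\alpha\vDash n$, let $\preccurlyeq_\alpha^t$ be any total order on $\mathrm{SRCT}(\alpha)$ extending the partial order $\preccurlyeq_\alpha$, and let $\tau_1\in\mathrm{SRCT}(\alpha)$ be the minimal element under $\preccurlyeq_\alpha^t$. Then $\mathcal{V}_{\tau_1}=\mathrm{span}_{\mathbb{C}}\{\tau_j\in\mathrm{SRCT}(\alpha) : \tau_1\preccurlyeq_\alpha^t\tau_j\}$ (with $T_i$ acting as $\pi_i$) is an $H_n(0)$-module whose quasisymmetric characteristic is the quasisymmetric Schur function $\mathcal{S}_\alpha$, that is, $ch([\mathcal{V}_{\tau_1}])=\mathcal{S}_\alpha$.
   Context: A composition $\alpha=(\alpha_1,\ldots,\alpha_k)$ of $n$ ($\alpha\vDash n$) is an ordered list of positive integers summing to $n$. For $S=\{i_1<\cdots<i_k\}\subseteq[n-1]$ let $\mathrm{comp}(S)=(i_1,i_2-i_1,\ldots,n-i_k)$, and for $\alpha\vDash n$ let $\mathrm{set}(\alpha)=\{\alpha_1,\alpha_1+\alpha_2,\ldots,\alpha_1+\cdots+\alpha_{k-1}\}$. The reverse composition diagram of $\alpha$ is the array of left-justified cells with $\alpha_i$ cells in row $i$ from the top; $(i,j)$ is the cell in row $i$, column $j$. A standard reverse composition tableau (SRCT) of shape $\alpha\vDash n$ is a bijective filling $\tau:\alpha\to\{1,\ldots,n\}$ such that (1) rows decrease from left to right; (2) the first column increases from top to bottom; (3) (triple rule) if $i<j$ and $\tau(i,k)>\tau(j,k+1)$, then $\tau(i,k+1)$ exists and $\tau(i,k+1)>\tau(j,k+1)$.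 $\mathrm{SRCT}(\alpha)$ is the set of SRCTs of shape $\alpha$. $\mathrm{Des}(\tau)=\{i\in[n-1]: i+1\text{ appears weakly right of } i\}$ and $\mathrm{comp}(\tau)=\mathrm{comp}(\mathrm{Des}(\tau))$. Entries $i,i+1$ are attacking in $\tau$ if they are in the same column, or in adjacent columns with $i+1$ strictly southeast of $i$. For $1\leq i\leq n-1$, $\pi_i(\tau)=\tau$ if $i\notin\mathrm{Des}(\tau)$; $\pi_i(\tau)=0$ if $i\in\mathrm{Des}(\tau)$ and $i,i+1$ are attacking; and $\pi_i(\tau)=s_i(\tau)$, the SRCT obtained by interchanging the positions of $i$ and $i+1$, if $i\in\mathrm{Des}(\tau)$ and $i,i+1$ are non-attacking; extend linearly. The $\pi_i$ satisfy the relations of the $0$-Hecke algebra $H_n(0)$, the $\mathbb{C}$-algebra generated by $T_1,\ldots,T_{n-1}$ with $T_i^2=T_i$, $T_iT_{i+1}T_i=T_{i+1}T_iT_{i+1}$, $T_iT_j=T_jT_i$ for $|i-j|\geq2$; so $\pi_\sigma:=\pi_{i_1}\cdots\pi_{i_p}$ is well defined for $\sigma\in\mathfrak{S}_n$ with reduced word $s_{i_1}\cdots s_{i_p}$. The partial order on $\mathrm{SRCT}(\alpha)$ is: $\tau\preccurlyeq_\alpha\tau'$ iff $\pi_\sigma(\tau)=\tau'$ for some $\sigma\in\mathfrak{S}_n$. The fundamental quasisymmetric function is $F_\alpha=\sum x_{i_1}\cdots x_{i_n}$ over $1\leq i_1\leq\cdots\leq i_n$ with $i_j<i_{j+1}$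 if $j\in\mathrm{set}(\alpha)$. The quasisymmetric Schur function is $\mathcal{S}_\alpha=\sum_{\tau\in\mathrm{SRCT}(\alpha)}F_{\mathrm{comp}(\tau)}$. The irreducible $H_n(0)$-modules are the one-dimensional modules $\mathbf{F}_\alpha=\mathbb{C}v_\alpha$, $\alpha\vDash n$, with $T_iv_\alpha=0$ if $i\in\mathrm{set}(\alpha)$ and $T_iv_\alpha=v_\alpha$ otherwise. The quasisymmetric characteristic $ch$ is the linear map from the Grothendieck group of finite-dimensional $H_n(0)$-modules (with $[M]=[M']+[M'']$ for short exact sequences $0\to M'\to M\to M''\to0$) to quasisymmetric functions with $ch([\mathbf{F}_\alpha])=F_\alpha$. *)

theory Defs
  imports
    Complex_Main
    "HOL-Library.Multiset"
    "HOL-Library.Poly_Mapping"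
    "HOL-Library.FuncSet"
    "HOL-Combinatorics.Permutations"
    "HOL-Algebra.Free_Abelian_Groups"
begin

section \<open>Compositions\<close>

definition is_composition :: "nat \<Rightarrow> nat list \<Rightarrow> bool" where
  "is_composition n \<alpha> \<longleftrightarrow> (\<forall>a\<in>set \<alpha>. 0 < a) \<and> sum_list \<alpha> = n"

definition comp_set :: "nat list \<Rightarrow> nat set" where
  "comp_set \<alpha> = {sum_list (take k \<alpha>) | k. 1 \<le> k \<and> k < length \<alpha>}"

text \<open>For \<open>n > 0\<close> and \<open>S = {i\<^sub>1 < \<dots> < i\<^sub>k}\<close> this is the list of successive differences of
  \<open>0, i\<^sub>1, \<dots>, i\<^sub>k, n\<close>. The only composition of \<open>0\<close> is the empty one.\<close>

definition comp_of_set :: "nat \<Rightarrow> nat set \<Rightarrow> nat list" where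
  "comp_of_set n S =
     (if n = 0 then []
      else (let xs = sorted_list_of_set S in map2 (-) (xs @ [n]) (0 # xs)))"


section \<open>Standard reverse composition tableaux\<close>

text \<open>Cells are pairs (row, column), both counted from 1, with row 1 at the top. A filling is
  \<open>undefined\<close> outside the diagram, so that fillings of a shape are equal as soon as they agree
  on the diagram.\<close>

type_synonym filling = "nat \<times> nat \<Rightarrow> nat"

definition diagram :: "nat list \<Rightarrow> (nat \<times> nat) set" where
  "diagram \<alpha> = {(i, j). 1 \<le> i \<and> i \<le> length \<alpha> \<and> 1 \<le> j \<and> j \<le> \<alpha> ! (i - 1)}"

definition SRCT :: "nat list \<Rightarrow> filling set" where
  "SRCT \<alpha> = {\<tau> \<in> extensional (diagram \<alpha>).
     bij_betw \<tau> (diagram \<alpha>) {1..sum_list \<alpha>} \<and>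
     (\<forall>i j j'. (i, j) \<in> diagram \<alpha> \<longrightarrow> (i, j') \<in> diagram \<alpha> \<longrightarrow> j < j' \<longrightarrow> \<tau> (i, j) > \<tau> (i, j')) \<and>
     (\<forall>i i'. (i, 1) \<in> diagram \<alpha> \<longrightarrow> (i', 1) \<in> diagram \<alpha> \<longrightarrow> i < i' \<longrightarrow> \<tau> (i, 1) < \<tau> (i', 1)) \<and>
     (\<forall>i j k. (i, k) \<in> diagram \<alpha> \<longrightarrow> (j, k + 1) \<in> diagram \<alpha> \<longrightarrow> i < j \<longrightarrow> \<tau> (i, k) > \<tau> (j, k + 1) \<longrightarrow>
        (i, k + 1) \<in> diagram \<alpha> \<and> \<tau> (i, k + 1) > \<tau> (j, k + 1))}"

definition cell_of :: "nat list \<Rightarrow> filling \<Rightarrow> nat \<Rightarrow> nat \<times> nat" where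
  "cell_of \<alpha> \<tau> m = the_inv_into (diagram \<alpha>) \<tau> m"

abbreviation row_of :: "nat list \<Rightarrow> filling \<Rightarrow> nat \<Rightarrow> nat" where
  "row_of \<alpha> \<tau> m \<equiv> fst (cell_of \<alpha> \<tau> m)"

abbreviation col_of :: "nat list \<Rightarrow> filling \<Rightarrow> nat \<Rightarrow> nat" where
  "col_of \<alpha> \<tau> m \<equiv> snd (cell_of \<alpha> \<tau> m)"

definition Des :: "nat list \<Rightarrow> filling \<Rightarrow> nat set" where
  "Des \<alpha> \<tau> = {i \<in> {1..<sum_list \<alpha>}. col_of \<alpha> \<tau> i \<le> col_of \<alpha> \<tau> (i + 1)}"

definition comp_tab :: "nat list \<Rightarrow> filling \<Rightarrow> nat list" where
  "comp_tab \<alpha> \<tau> = comp_of_set (sum_list \<alpha>) (Des \<alpha> \<tau>)"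

definition attacking :: "nat list \<Rightarrow> filling \<Rightarrow> nat \<Rightarrow> bool" where
  "attacking \<alpha> \<tau> i \<longleftrightarrow>
     col_of \<alpha> \<tau> i = col_of \<alpha> \<tau> (i + 1) \<or>
     (col_of \<alpha> \<tau> (i + 1) = col_of \<alpha> \<tau> i + 1 \<and> row_of \<alpha> \<tau> i < row_of \<alpha> \<tau> (i + 1))"

definition swap_entries :: "nat list \<Rightarrow> nat \<Rightarrow> filling \<Rightarrow> filling" where
  "swap_entries \<alpha> i \<tau> = restrict (transpose i (i + 1) \<circ> \<tau>) (diagram \<alpha>)"


section \<open>The complex vector space with a given basis\<close>

text \<open>\<open>'b \<Rightarrow>\<^sub>0 complex\<close> is the complex vector space with basis \<open>'b\<close>; the basis vector belonging
  to \<open>b\<close> is \<open>Poly_Mapping.single b 1\<close>.\<close>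

definition cscale :: "complex \<Rightarrow> ('b \<Rightarrow>\<^sub>0 complex) \<Rightarrow> ('b \<Rightarrow>\<^sub>0 complex)" where
  "cscale c v = Poly_Mapping.map ((*) c) v"

lemma lookup_cscale [simp]: "Poly_Mapping.lookup (cscale c v) b = c * Poly_Mapping.lookup v b"
  by (simp add: cscale_def map.rep_eq when_def)

global_interpretation cvs: vector_space cscale
  by unfold_locales (auto intro!: poly_mapping_eqI simp: lookup_add algebra_simps)

abbreviation basis_vec :: "'b \<Rightarrow> ('b \<Rightarrow>\<^sub>0 complex)" where
  "basis_vec b \<equiv> Poly_Mapping.single b 1"


section \<open>The operators \<open>\<pi>\<^sub>i\<close> and the partial order on tableaux\<close>

definition pi_basis :: "nat list \<Rightarrow> nat \<Rightarrow> filling \<Rightarrow> (filling \<Rightarrow>\<^sub>0 complex)" where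
  "pi_basis \<alpha> i \<tau> =
     (if i \<notin> Des \<alpha> \<tau> then basis_vec \<tau>
      else if attacking \<alpha> \<tau> i then 0
      else basis_vec (swap_entries \<alpha> i \<tau>))"

definition pi_op :: "nat list \<Rightarrow> nat \<Rightarrow> (filling \<Rightarrow>\<^sub>0 complex) \<Rightarrow> (filling \<Rightarrow>\<^sub>0 complex)" where
  "pi_op \<alpha> i v = (\<Sum>\<tau>\<in>Poly_Mapping.keys v. cscale (Poly_Mapping.lookup v \<tau>) (pi_basis \<alpha> i \<tau>))"

definition word_perm :: "nat list \<Rightarrow> (nat \<Rightarrow> nat)" where
  "word_perm w = foldr (\<lambda>i \<sigma>. transpose i (i + 1) \<circ> \<sigma>) w id"

definition reduced_word :: "nat \<Rightarrow> (nat \<Rightarrow> nat) \<Rightarrow> nat list \<Rightarrow> bool" where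
  "reduced_word n \<sigma> w \<longleftrightarrow>
     set w \<subseteq> {1..<n} \<and> word_perm w = \<sigma> \<and>
     (\<forall>w'. set w' \<subseteq> {1..<n} \<longrightarrow> word_perm w' = \<sigma> \<longrightarrow> length w \<le> length w')"

text \<open>The choice of the reduced word does not matter, because the \<open>\<pi>\<^sub>i\<close> satisfy the braid
  relations on the span of \<open>SRCT \<alpha>\<close>.\<close>

definition pi_perm :: "nat list \<Rightarrow> (nat \<Rightarrow> nat) \<Rightarrow> (filling \<Rightarrow>\<^sub>0 complex) \<Rightarrow> (filling \<Rightarrow>\<^sub>0 complex)" where
  "pi_perm \<alpha> \<sigma> = foldr (pi_op \<alpha>) (SOME w. reduced_word (sum_list \<alpha>) \<sigma> w)"

definition srct_order :: "nat list \<Rightarrow> filling rel" where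
  "srct_order \<alpha> = {(\<tau>, \<tau>'). \<tau> \<in> SRCT \<alpha> \<and> \<tau>' \<in> SRCT \<alpha> \<and>
     (\<exists>\<sigma>. \<sigma> permutes {1..sum_list \<alpha>} \<and> pi_perm \<alpha> \<sigma> (basis_vec \<tau>) = basis_vec \<tau>')}"


section \<open>Quasisymmetric functions\<close>

text \<open>A formal power series in \<open>x\<^sub>1, x\<^sub>2, \<dots>\<close> with integer coefficients is given by its
  coefficients. The variable \<open>x\<^bsub>i+1\<^esub>\<close> is represented by the natural number \<open>i\<close>, and the monomial
  \<open>x\<^bsub>i\<^sub>1\<^esub> \<cdots> x\<^bsub>i\<^sub>n\<^esub>\<close> by the multiset of its variables.\<close>

type_synonym power_series = "nat multiset \<Rightarrow> int"

definition QSym :: "power_series set" where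
  "QSym = {f. (\<exists>d. \<forall>m. d < size m \<longrightarrow> f m = 0) \<and>
              (\<forall>m \<phi>. strict_mono_on (set_mset m) \<phi> \<longrightarrow> f (image_mset \<phi> m) = f m)}"

definition QSym_group :: "power_series monoid" where
  "QSym_group = \<lparr>carrier = QSym, monoid.mult = (\<lambda>f g m. f m + g m), one = (\<lambda>m. 0)\<rparr>"

text \<open>The strictness condition at \<open>j \<in> set(\<alpha>)\<close> compares the \<open>j\<close>-th and \<open>(j+1)\<close>-st terms, which
  sit at positions \<open>j - 1\<close> and \<open>j\<close> of the list.\<close>

definition fundamental_qsym :: "nat list \<Rightarrow> power_series" where
  "fundamental_qsym \<alpha> m = int (card {xs :: nat list.
     length xs = sum_list \<alpha> \<and> sorted xs \<and> (\<forall>j\<in>comp_set \<alpha>. xs ! (j - 1) < xs ! j) \<and> mset xs = m})"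

definition schur_qsym :: "nat list \<Rightarrow> power_series" where
  "schur_qsym \<alpha> m = (\<Sum>\<tau>\<in>SRCT \<alpha>. fundamental_qsym (comp_tab \<alpha> \<tau>) m)"


section \<open>Modules over the 0-Hecke algebra\<close>

text \<open>Since \<open>H\<^sub>n(0)\<close> is the algebra presented by the generators \<open>T\<^sub>1, \<dots>, T\<^bsub>n-1\<^esub>\<close> and the 0-Hecke
  relations, an \<open>H\<^sub>n(0)\<close>-module is a complex vector space together with linear operators
  \<open>T\<^sub>1, \<dots>, T\<^bsub>n-1\<^esub>\<close> satisfying these relations. It is represented as a pair \<open>(V, T)\<close>, where \<open>V\<close> is a
  subspace of \<open>'b \<Rightarrow>\<^sub>0 complex\<close>; only the values of \<open>T i\<close> on \<open>V\<close> for \<open>1 \<le> i < n\<close> are relevant.\<close>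

type_synonym 'b hmodule =
  "('b \<Rightarrow>\<^sub>0 complex) set \<times> (nat \<Rightarrow> ('b \<Rightarrow>\<^sub>0 complex) \<Rightarrow> ('b \<Rightarrow>\<^sub>0 complex))"

definition linear_map_on ::
    "('b \<Rightarrow>\<^sub>0 complex) set \<Rightarrow> ('b \<Rightarrow>\<^sub>0 complex) set \<Rightarrow> (('b \<Rightarrow>\<^sub>0 complex) \<Rightarrow> ('b \<Rightarrow>\<^sub>0 complex)) \<Rightarrow> bool" where
  "linear_map_on V W f \<longleftrightarrow>
     f \<in> V \<rightarrow> W \<and> (\<forall>x\<in>V. \<forall>y\<in>V. f (x + y) = f x + f y) \<and> (\<forall>c. \<forall>x\<in>V. f (cscale c x) = cscale c (f x))"

definition hecke_module :: "nat \<Rightarrow> 'b hmodule \<Rightarrow> bool" where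
  "hecke_module n M \<longleftrightarrow> (case M of (V, T) \<Rightarrow>
     cvs.subspace V \<and>
     (\<forall>i\<in>{1..<n}. linear_map_on V V (T i)) \<and>
     (\<forall>i\<in>{1..<n}. \<forall>v\<in>V. T i (T i v) = T i v) \<and>
     (\<forall>i\<in>{1..<n}. i + 1 \<in> {1..<n} \<longrightarrow>
        (\<forall>v\<in>V. T i (T (i + 1) (T i v)) = T (i + 1) (T i (T (i + 1) v)))) \<and>
     (\<forall>i\<in>{1..<n}. \<forall>j\<in>{1..<n}. \<bar>int i - int j\<bar> \<ge> 2 \<longrightarrow> (\<forall>v\<in>V. T i (T j v) = T j (T i v))))"

definition finite_dim :: "('b \<Rightarrow>\<^sub>0 complex) set \<Rightarrow> bool" where
  "finite_dim V \<longleftrightarrow> (\<exists>B. finite B \<and> cvs.span B = V)"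

definition fd_hecke_modules :: "nat \<Rightarrow> 'b hmodule set" where
  "fd_hecke_modules n = {M. hecke_module n M \<and> finite_dim (fst M)}"

definition hecke_hom :: "nat \<Rightarrow> 'b hmodule \<Rightarrow> 'b hmodule \<Rightarrow> (('b \<Rightarrow>\<^sub>0 complex) \<Rightarrow> ('b \<Rightarrow>\<^sub>0 complex)) \<Rightarrow> bool" where
  "hecke_hom n M N f \<longleftrightarrow>
     linear_map_on (fst M) (fst N) f \<and>
     (\<forall>i\<in>{1..<n}. \<forall>v\<in>fst M. f (snd M i v) = snd N i (f v))"

definition short_exact :: "nat \<Rightarrow> 'b hmodule \<Rightarrow> 'b hmodule \<Rightarrow> 'b hmodule \<Rightarrow> bool" where
  "short_exact n M' M M'' \<longleftrightarrow>
     (\<exists>f g. hecke_hom n M' M f \<and> hecke_hom n M M'' g \<and>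
            inj_on f (fst M') \<and> f ` fst M' = {v \<in> fst M. g v = 0} \<and> g ` fst M = fst M'')"

text \<open>The Grothendieck group is the free abelian group on the finite-dimensional modules
  modulo the subgroup generated by the elements \<open>M - M' - M''\<close> for short exact sequences.
  When \<open>'b\<close> is infinite, every finite-dimensional module is isomorphic to one carried by a
  subspace of \<open>'b \<Rightarrow>\<^sub>0 complex\<close>, so this is the full Grothendieck group.\<close>

definition exact_relations :: "nat \<Rightarrow> ('b hmodule \<Rightarrow>\<^sub>0 int) set" where
  "exact_relations n = {frag_of M - frag_of M' - frag_of M'' | M M' M''.
     M \<in> fd_hecke_modules n \<and> M' \<in> fd_hecke_modules n \<and> M'' \<in> fd_hecke_modules n \<and>
     short_exact n M' M M''}"

definition relation_subgroup :: "nat \<Rightarrow> ('b hmodule \<Rightarrow>\<^sub>0 int) set" where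
  "relation_subgroup n = generate (free_Abelian_group (fd_hecke_modules n)) (exact_relations n)"

definition grothendieck_group :: "nat \<Rightarrow> ('b hmodule \<Rightarrow>\<^sub>0 int) set monoid" where
  "grothendieck_group n = free_Abelian_group (fd_hecke_modules n) Mod relation_subgroup n"

definition module_class :: "nat \<Rightarrow> 'b hmodule \<Rightarrow> ('b hmodule \<Rightarrow>\<^sub>0 int) set" where
  "module_class n M = relation_subgroup n #>\<^bsub>free_Abelian_group (fd_hecke_modules n)\<^esub> frag_of M"

text \<open>The irreducible module \<open>\<^bold>F\<^sub>\<alpha> = \<complex>v\<close>, for a nonzero vector \<open>v\<close>.\<close>

definition irreducible_module :: "nat list \<Rightarrow> ('b \<Rightarrow>\<^sub>0 complex) \<Rightarrow> 'b hmodule" where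
  "irreducible_module \<alpha> v = (cvs.span {v}, \<lambda>i x. if i \<in> comp_set \<alpha> then 0 else x)"

text \<open>The quasisymmetric characteristic \<open>ch\<close> of \<open>H\<^sub>n(0)\<close> is characterised by its values on the
  classes \<open>[\<^bold>F\<^sub>\<alpha>]\<close>, which form a basis of the Grothendieck group. The different choices
  of \<open>v \<noteq> 0\<close> give isomorphic modules, hence the same class.\<close>

definition quasisymmetric_characteristic ::
    "nat \<Rightarrow> (('b hmodule \<Rightarrow>\<^sub>0 int) set \<Rightarrow> power_series) \<Rightarrow> bool" where
  "quasisymmetric_characteristic n ch \<longleftrightarrow>
     ch \<in> hom (grothendieck_group n) QSym_group \<and>
     (\<forall>\<alpha> v. is_composition n \<alpha> \<longrightarrow> v \<noteq> 0 \<longrightarrow>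
        ch (module_class n (irreducible_module \<alpha> v)) = fundamental_qsym \<alpha>)"


section \<open>The module \<open>\<V>\<^bsub>\<tau>\<^sub>1\<^esub>\<close>\<close>

definition srct_module :: "nat list \<Rightarrow> filling rel \<Rightarrow> filling \<Rightarrow> filling hmodule" where
  "srct_module \<alpha> r \<tau>\<^sub>1 = (cvs.span {basis_vec \<tau> | \<tau>. \<tau> \<in> SRCT \<alpha> \<and> (\<tau>\<^sub>1, \<tau>) \<in> r}, pi_op \<alpha>)"

end

theory Submission
  imports Defs
begin

text \<open>For \<open>i \<in> Des \<tau>\<close> with \<open>i, i+1\<close> non-attacking, interchanging the two entries affects no
  comparison occurring in the definition of an SRCT. Whether \<open>\<pi>\<^sub>i\<close> fixes, kills or moves \<open>\<tau>\<close>
  depends only on the cells of \<open>i\<close> and \<open>i+1\<close>, so the braid relation is a finite check on the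
  cells of \<open>i\<close>, \<open>i+1\<close>, \<open>i+2\<close>. A move strictly decreases \<open>\<Sum>m. m * col(m)\<close>; hence, in a set \<open>S\<close> of
  tableaux closed under the moves, a tableau \<open>\<tau>\<close> maximising this weight can be removed, and the
  span of \<open>S\<close> is an extension of \<open>\<^bold>F\<^bsub>comp(\<tau>)\<^esub>\<close> by the span of \<open>S - {\<tau>}\<close>. The characteristic follows
  by induction on the cardinality of \<open>S\<close>, starting the filtration with \<open>S = SRCT(\<alpha>)\<close>.\<close>

section \<open>Compositions of descent sets\<close>

text \<open>The sums telescope, and sortedness keeps the subtraction of natural numbers from
  truncating. The start \<open>a\<close> is arbitrary because the induction moves it to the next
  list entry.\<close>

lemma sum_list_take_differences:
  fixes xs :: "nat list"
  assumes "sorted (a # xs @ [n])" and "k \<le> Suc (length xs)"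
  shows "a + sum_list (take k (map2 (-) (xs @ [n]) (a # xs))) = (a # xs @ [n]) ! k"
  using assms
proof (induction xs arbitrary: a k)
  case Nil
  then show ?case by (cases k) auto
next
  case (Cons b xs)
  show ?case
  proof (cases k)
    case (Suc l)
    have "b + sum_list (take l (map2 (-) (xs @ [n]) (b # xs))) = (b # xs @ [n]) ! l"
      using Cons.prems Suc by (intro Cons.IH) auto
    then show ?thesis
      using Cons.prems Suc by simp
  qed simp
qed

lemma differences_pos:
  fixes xs :: "nat list"
  assumes "sorted_wrt (<) (a # xs @ [n])"
  shows "\<forall>d \<in> set (map2 (-) (xs @ [n]) (a # xs)). 0 < d"
  using assms
proof (induction xs arbitrary: a)
  case (Cons b xs)
  have "\<forall>d \<in> set (map2 (-) (xs @ [n]) (b # xs)). 0 < d"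
    using Cons.prems by (intro Cons.IH) auto
  then show ?case
    using Cons.prems by simp
qed simp

context
  fixes n :: nat and D :: "nat set"
  assumes D: "D \<subseteq> {1..<n}"
begin

lemma comp_of_set_sorted:
  "sorted_wrt (<) (0 # sorted_list_of_set D @ [n])" if "0 < n"
proof -
  have "finite D"
    using D finite_subset by blast
  then show ?thesis
    using D that by (auto simp: sorted_wrt_append)
qed

lemma is_composition_comp_of_set: "is_composition n (comp_of_set n D)"
proof (cases "n = 0")
  case False
  let ?xs = "sorted_list_of_set D"
  have s: "sorted_wrt (<) (0 # ?xs @ [n])"
    using comp_of_set_sorted False by simp
  \<comment> \<open>All \<open>Suc (length ?xs)\<close> differences together reach the last entry,
    \<open>n\<close>.\<close>
  have "sum_list (map2 (-) (?xs @ [n]) (0 # ?xs)) = n"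
    using sum_list_take_differences[of 0 ?xs n "Suc (length ?xs)"] strict_sorted_imp_sorted[OF s]
    by (simp add: nth_append)
  then show ?thesis
    using differences_pos[OF s] False by (simp add: is_composition_def comp_of_set_def Let_def)
qed (simp add: is_composition_def comp_of_set_def)

text \<open>Through this identity the descents of a tableau become the indices that annihilate the
  irreducible module attached to it.\<close>

lemma comp_set_comp_of_set: "comp_set (comp_of_set n D) = D"
proof (cases "n = 0")
  case False
  let ?xs = "sorted_list_of_set D"
  let ?ds = "map2 (-) (?xs @ [n]) (0 # ?xs)"
  have s: "sorted (0 # ?xs @ [n])"
    using comp_of_set_sorted False strict_sorted_imp_sorted by blast
  have "finite D"
    using D finite_subset by blast
  \<comment> \<open>The leading \<open>0\<close> shifts indices: the first \<open>Suc k\<close>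
    differences end at entry \<open>k\<close> of \<open>?xs\<close>.\<close>
  have "sum_list (take (Suc k) ?ds) = ?xs ! k" if "k < length ?xs" for k
    using sum_list_take_differences[OF s, of "Suc k"] that by (simp add: nth_append)
  then have "(\<lambda>k. sum_list (take (Suc k) ?ds)) ` {..<length ?xs} = {?xs ! k | k. k < length ?xs}"
    by (auto simp del: length_sorted_list_of_set)
  moreover have "{sum_list (take k ?ds) | k. 1 \<le> k \<and> k < length ?ds} =
      (\<lambda>k. sum_list (take (Suc k) ?ds)) ` {..<length ?xs}"
  proof -
    have "{sum_list (take k ?ds) | k. 1 \<le> k \<and> k < length ?ds} =
        (\<lambda>k. sum_list (take k ?ds)) ` {1..<Suc (length ?xs)}"
      by auto
    also have "{1..<Suc (length ?xs)} = Suc ` {..<length ?xs}"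
      by (simp add: lessThan_atLeast0)
    finally show ?thesis
      by (simp add: image_image)
  qed
  ultimately have "{sum_list (take k ?ds) | k. 1 \<le> k \<and> k < length ?ds} = {?xs ! k | k. k < length ?xs}"
    by simp
  also have "\<dots> = D"
    using \<open>finite D\<close> set_conv_nth[of ?xs] by simp
  finally show ?thesis
    using False by (simp add: comp_set_def comp_of_set_def Let_def)
qed (use D in \<open>simp add: comp_set_def comp_of_set_def\<close>)

end


section \<open>Interchanging entries\<close>

lemma finite_diagram: "finite (diagram \<alpha>)"
proof (rule finite_subset)
  show "diagram \<alpha> \<subseteq> {..length \<alpha>} \<times> {..sum_list \<alpha>}"
  proof clarify
    fix i j assume "(i, j) \<in> diagram \<alpha>"
    then have ij: "1 \<le> i" "i \<le> length \<alpha>" "j \<le> \<alpha> ! (i - 1)"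
      by (simp_all add: diagram_def)
    then have "\<alpha> ! (i - 1) \<le> sum_list \<alpha>"
      by (intro member_le_sum_list nth_mem) auto
    with ij show "i \<in> {..length \<alpha>} \<and> j \<in> {..sum_list \<alpha>}"
      by simp
  qed
qed simp

lemma bij_betw_SRCT: "\<tau> \<in> SRCT \<alpha> \<Longrightarrow> bij_betw \<tau> (diagram \<alpha>) {1..sum_list \<alpha>}"
  by (simp add: SRCT_def)

text \<open>Being \<open>undefined\<close> off the diagram, the tableaux form a subset of a finite
  product of intervals.\<close>

lemma finite_SRCT: "finite (SRCT \<alpha>)"
proof (rule finite_subset)
  show "SRCT \<alpha> \<subseteq> (\<Pi>\<^sub>E c\<in>diagram \<alpha>. {1..sum_list \<alpha>})"
  proof
    fix \<tau> assume \<tau>: "\<tau> \<in> SRCT \<alpha>"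
    then have "\<tau> \<in> extensional (diagram \<alpha>)"
      by (simp add: SRCT_def)
    then show "\<tau> \<in> (\<Pi>\<^sub>E c\<in>diagram \<alpha>. {1..sum_list \<alpha>})"
      using bij_betw_imp_funcset[OF bij_betw_SRCT[OF \<tau>]] by (simp add: PiE_def)
  qed
  show "finite (\<Pi>\<^sub>E c\<in>diagram \<alpha>. {1..sum_list \<alpha>})"
    by (intro finite_PiE finite_diagram) simp
qed

lemma cell_of_works:
  assumes "\<tau> \<in> SRCT \<alpha>" and "m \<in> {1..sum_list \<alpha>}"
  shows "cell_of \<alpha> \<tau> m \<in> diagram \<alpha>" and "\<tau> (cell_of \<alpha> \<tau> m) = m"
proof -
  note bij = bij_betw_SRCT[OF assms(1)]
  have im: "m \<in> \<tau> ` diagram \<alpha>"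
    using bij_betw_imp_surj_on[OF bij] assms(2) by simp
  show "cell_of \<alpha> \<tau> m \<in> diagram \<alpha>"
    unfolding cell_of_def by (rule the_inv_into_into[OF bij_betw_imp_inj_on[OF bij] im order.refl])
  show "\<tau> (cell_of \<alpha> \<tau> m) = m"
    unfolding cell_of_def by (rule f_the_inv_into_f[OF bij_betw_imp_inj_on[OF bij] im])
qed

lemma cell_of_eqI:
  assumes "\<tau> \<in> SRCT \<alpha>" and "c \<in> diagram \<alpha>"
  shows "cell_of \<alpha> \<tau> (\<tau> c) = c"
  unfolding cell_of_def
  by (rule the_inv_into_f_f[OF bij_betw_imp_inj_on[OF bij_betw_SRCT[OF assms(1)]] assms(2)])

section \<open>Moves along non-attacking descents\<close>

text \<open>No number lies strictly between \<open>i\<close> and \<open>i + 1\<close>, so only the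
  comparison of these two can be reversed.\<close>

lemma transpose_less_iff:
  fixes i x y :: nat
  assumes "{x, y} \<noteq> {i, i + 1}"
  shows "transpose i (i + 1) x < transpose i (i + 1) y \<longleftrightarrow> x < y"
  using assms by (auto simp: transpose_def)

text \<open>The rules compare two cells only if they share a row or a column, or if one lies
  strictly southeast of the other in the next column. A non-attacking descent puts \<open>i\<close>
  strictly left of \<open>i + 1\<close>, which leaves only the row and the diagonal to
  exclude.\<close>

lemma swap_entries_SRCT:
  assumes \<tau>: "\<tau> \<in> SRCT \<alpha>" and i: "i \<in> Des \<alpha> \<tau>" and na: "\<not> attacking \<alpha> \<tau> i"
  shows "swap_entries \<alpha> i \<tau> \<in> SRCT \<alpha>"
proof -
  let ?t = "transpose i (i + 1)"
  have i_range: "i \<in> {1..sum_list \<alpha>}" "i + 1 \<in> {1..sum_list \<alpha>}"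
    using i by (auto simp: Des_def)
  obtain a b where ab: "cell_of \<alpha> \<tau> i = (a, b)"
    by fastforce
  obtain a' b' where ab': "cell_of \<alpha> \<tau> (i + 1) = (a', b')"
    by fastforce
  have col: "b < b'" and not_diag: "b' = b + 1 \<Longrightarrow> \<not> a < a'"
    using i na ab ab' by (auto simp: Des_def attacking_def)
  have cells: "\<tau> (a, b) = i" "\<tau> (a', b') = i + 1" "(a, b) \<in> diagram \<alpha>" "(a', b') \<in> diagram \<alpha>"
    using cell_of_works[OF \<tau> i_range(1)] cell_of_works[OF \<tau> i_range(2)] ab ab' by auto
  have lt: "?t (\<tau> c) < ?t (\<tau> d) \<longleftrightarrow> \<tau> c < \<tau> d"
    if "c \<in> diagram \<alpha>" "d \<in> diagram \<alpha>"
      and "c = (a, b) \<Longrightarrow> d \<noteq> (a', b')" and "d = (a, b) \<Longrightarrow> c \<noteq> (a', b')" for c d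
  proof (rule transpose_less_iff, rule notI)
    assume "{\<tau> c, \<tau> d} = {i, i + 1}"
    then consider "\<tau> c = i" "\<tau> d = i + 1" | "\<tau> d = i" "\<tau> c = i + 1"
      by (auto simp: doubleton_eq_iff)
    then show False
      using that cell_of_eqI[OF \<tau>, of c] cell_of_eqI[OF \<tau>, of d] ab ab' by cases auto
  qed
  have row_dec: "\<And>x j j'. (x, j) \<in> diagram \<alpha> \<Longrightarrow> (x, j') \<in> diagram \<alpha> \<Longrightarrow> j < j' \<Longrightarrow> \<tau> (x, j') < \<tau> (x, j)"
    and col_inc: "\<And>x x'. (x, 1) \<in> diagram \<alpha> \<Longrightarrow> (x', 1) \<in> diagram \<alpha> \<Longrightarrow> x < x' \<Longrightarrow> \<tau> (x, 1) < \<tau> (x', 1)"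
    and triple: "\<And>x y k. (x, k) \<in> diagram \<alpha> \<Longrightarrow> (y, k + 1) \<in> diagram \<alpha> \<Longrightarrow> x < y \<Longrightarrow>
      \<tau> (y, k + 1) < \<tau> (x, k) \<Longrightarrow> (x, k + 1) \<in> diagram \<alpha> \<and> \<tau> (y, k + 1) < \<tau> (x, k + 1)"
    using \<tau> by (auto simp: SRCT_def)
  \<comment> \<open>\<open>i\<close> and \<open>i + 1\<close> cannot share a row, because the larger
    entry would stand further right.\<close>
  have rows: "?t (\<tau> (x, j')) < ?t (\<tau> (x, j))"
    if d: "(x, j) \<in> diagram \<alpha>" "(x, j') \<in> diagram \<alpha>" "j < j'" for x j j'
    by (subst lt) (use d col cells row_dec[OF d] in auto)
  have same_col: "?t (\<tau> (x, k)) < ?t (\<tau> (y, k)) \<longleftrightarrow> \<tau> (x, k) < \<tau> (y, k)"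
    if "(x, k) \<in> diagram \<alpha>" "(y, k) \<in> diagram \<alpha>" for x y k
    by (rule lt) (use that col in auto)
  \<comment> \<open>The cells of \<open>i\<close> and \<open>i + 1\<close> are no such pair: in one
    order the columns disagree, in the other the entries would be attacking.\<close>
  have diag: "?t (\<tau> (y, k + 1)) < ?t (\<tau> (x, k)) \<longleftrightarrow> \<tau> (y, k + 1) < \<tau> (x, k)"
    if "(x, k) \<in> diagram \<alpha>" "(y, k + 1) \<in> diagram \<alpha>" "x < y" for x y k
    by (rule lt) (use that col not_diag in auto)
  have eq: "swap_entries \<alpha> i \<tau> c = ?t (\<tau> c)" if "c \<in> diagram \<alpha>" for c
    using that by (simp add: swap_entries_def)
  have "?t permutes {1..sum_list \<alpha>}"
    using i_range by (intro permutes_swap_id)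
  then have "bij_betw (?t \<circ> \<tau>) (diagram \<alpha>) {1..sum_list \<alpha>}"
    using bij_betw_trans[OF bij_betw_SRCT[OF \<tau>] permutes_imp_bij] by simp
  then have bij: "bij_betw (swap_entries \<alpha> i \<tau>) (diagram \<alpha>) {1..sum_list \<alpha>}"
    by (subst bij_betw_cong[where g = "?t \<circ> \<tau>"]) (auto simp: eq)
  have ext: "swap_entries \<alpha> i \<tau> \<in> extensional (diagram \<alpha>)"
    by (simp add: swap_entries_def)
  show ?thesis
    unfolding SRCT_def
  proof (intro CollectI conjI allI impI ext bij)
    fix x j j' assume d: "(x, j) \<in> diagram \<alpha>" "(x, j') \<in> diagram \<alpha>" "j < j'"
    then show "swap_entries \<alpha> i \<tau> (x, j') < swap_entries \<alpha> i \<tau> (x, j)"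
      using rows[OF d] by (simp only: eq)
  next
    fix x x' assume d: "(x, 1) \<in> diagram \<alpha>" "(x', 1) \<in> diagram \<alpha>" "x < x'"
    then show "swap_entries \<alpha> i \<tau> (x, 1) < swap_entries \<alpha> i \<tau> (x', 1)"
      using same_col[OF d(1,2)] col_inc[OF d] by (simp only: eq)
  next
    fix x y k
    assume d: "(x, k) \<in> diagram \<alpha>" "(y, k + 1) \<in> diagram \<alpha>" "x < y"
      and less: "swap_entries \<alpha> i \<tau> (y, k + 1) < swap_entries \<alpha> i \<tau> (x, k)"
    then have less': "\<tau> (y, k + 1) < \<tau> (x, k)"
      using diag[OF d] by (simp only: eq)
    note * = triple[OF d less']
    from * show "(x, k + 1) \<in> diagram \<alpha>" ..
    then show "swap_entries \<alpha> i \<tau> (y, k + 1) < swap_entries \<alpha> i \<tau> (x, k + 1)"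
      using * same_col[OF d(2)] d by (simp only: eq)
  qed
qed

lemma cell_of_swap_entries:
  assumes \<tau>: "\<tau> \<in> SRCT \<alpha>" and i: "i \<in> Des \<alpha> \<tau>" "\<not> attacking \<alpha> \<tau> i"
    and m: "m \<in> {1..sum_list \<alpha>}"
  shows "cell_of \<alpha> (swap_entries \<alpha> i \<tau>) m = cell_of \<alpha> \<tau> (transpose i (i + 1) m)"
proof -
  have tm: "transpose i (i + 1) m \<in> {1..sum_list \<alpha>}"
    using i(1) m by (auto simp: Des_def transpose_def)
  have "swap_entries \<alpha> i \<tau> (cell_of \<alpha> \<tau> (transpose i (i + 1) m)) = m"
    using cell_of_works[OF \<tau> tm] by (simp add: swap_entries_def)
  then show ?thesis
    using cell_of_eqI[OF swap_entries_SRCT[OF \<tau> i] cell_of_works(1)[OF \<tau> tm]] by simp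
qed

text \<open>On the diagram this is the braid relation of adjacent transpositions applied to the
  entries; off it both sides are \<open>undefined\<close>.\<close>

lemma swap_entries_braid:
  "swap_entries \<alpha> i (swap_entries \<alpha> (i + 1) (swap_entries \<alpha> i \<tau>)) =
   swap_entries \<alpha> (i + 1) (swap_entries \<alpha> i (swap_entries \<alpha> (i + 1) \<tau>))"
  by (rule ext) (auto simp: swap_entries_def restrict_def transpose_def)

lemma swap_entries_commute:
  assumes "i + 1 < j \<or> j + 1 < i"
  shows "swap_entries \<alpha> i (swap_entries \<alpha> j \<tau>) = swap_entries \<alpha> j (swap_entries \<alpha> i \<tau>)"
  using assms by (intro ext) (auto simp: swap_entries_def restrict_def transpose_def)

section \<open>A weight that drops under every move\<close>

definition col_weight :: "nat list \<Rightarrow> filling \<Rightarrow> nat" where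
  "col_weight \<alpha> \<tau> = (\<Sum>m = 1..sum_list \<alpha>. m * col_of \<alpha> \<tau> m)"

text \<open>The interchange lowers the weight by exactly the column distance from \<open>i\<close>
  to \<open>i + 1\<close>, which is positive; all other terms stay.\<close>

lemma col_weight_swap_entries:
  assumes \<tau>: "\<tau> \<in> SRCT \<alpha>" and i: "i \<in> Des \<alpha> \<tau>" "\<not> attacking \<alpha> \<tau> i"
  shows "col_weight \<alpha> (swap_entries \<alpha> i \<tau>) < col_weight \<alpha> \<tau>"
proof -
  let ?A = "{1..sum_list \<alpha>}" and ?t = "transpose i (i + 1)" and ?c = "col_of \<alpha> \<tau>"
  have col: "?c i < ?c (i + 1)"
    using i by (auto simp: Des_def attacking_def)
  have split: "(\<Sum>m\<in>?A. f m) = f i + f (i + 1) + (\<Sum>m\<in>?A - {i, i + 1}. f m)" for f :: "nat \<Rightarrow> nat"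
  proof -
    have "{i, i + 1} \<subseteq> ?A"
      using i(1) by (auto simp: Des_def)
    then show ?thesis
      by (subst sum.subset_diff[of "{i, i + 1}"]) auto
  qed
  have "col_weight \<alpha> (swap_entries \<alpha> i \<tau>) = (\<Sum>m\<in>?A. m * ?c (?t m))"
    unfolding col_weight_def by (intro sum.cong) (auto simp: cell_of_swap_entries[OF \<tau> i])
  also have "\<dots> = i * ?c (i + 1) + (i + 1) * ?c i + (\<Sum>m\<in>?A - {i, i + 1}. m * ?c m)"
    unfolding split by (simp add: transpose_def)
  also have "\<dots> < i * ?c i + (i + 1) * ?c (i + 1) + (\<Sum>m\<in>?A - {i, i + 1}. m * ?c m)"
    using col by (simp add: algebra_simps)
  also have "\<dots> = col_weight \<alpha> \<tau>"
    unfolding col_weight_def split by simp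
  finally show ?thesis .
qed


section \<open>Linear extension of the operators\<close>

global_interpretation cvs: vector_space_pair cscale cscale
  by unfold_locales

lemma keys_cscale: "Poly_Mapping.keys (cscale c v) \<subseteq> Poly_Mapping.keys v"
  by (auto simp: in_keys_iff)

text \<open>Turns membership in a span of tableaux into a condition on supports, so that removing
  one tableau amounts to a vanishing coefficient.\<close>

lemma span_basis_vec: "cvs.span (basis_vec ` S) = {v. Poly_Mapping.keys v \<subseteq> S}"
proof
  have "cvs.subspace {v :: 'a \<Rightarrow>\<^sub>0 complex. Poly_Mapping.keys v \<subseteq> S}"
    unfolding cvs.subspace_def
    by (auto dest: keys_cscale[THEN subsetD] keys_add[THEN subsetD])
  then show "cvs.span (basis_vec ` S) \<subseteq> {v. Poly_Mapping.keys v \<subseteq> S}"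
    by (intro cvs.span_minimal) auto
next
  show "{v. Poly_Mapping.keys v \<subseteq> S} \<subseteq> cvs.span (basis_vec ` S)"
  proof
    fix v :: "'a \<Rightarrow>\<^sub>0 complex"
    assume "v \<in> {v. Poly_Mapping.keys v \<subseteq> S}"
    then have "(\<Sum>\<tau>\<in>Poly_Mapping.keys v. cscale (Poly_Mapping.lookup v \<tau>) (basis_vec \<tau>))
      \<in> cvs.span (basis_vec ` S)"
      by (intro cvs.span_sum cvs.span_scale cvs.span_base) auto
    also have "(\<Sum>\<tau>\<in>Poly_Mapping.keys v. cscale (Poly_Mapping.lookup v \<tau>) (basis_vec \<tau>)) = v"
      by (rule poly_mapping_eqI)
        (simp add: lookup_sum lookup_single when_def if_distrib[where f = "(*) _"] sum.delta' in_keys_iff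
          cong: if_cong)
    finally show "v \<in> cvs.span (basis_vec ` S)" .
  qed
qed

text \<open>Linearity compares vectors with different supports; a common finite index set only adds
  zero terms.\<close>

lemma pi_op_eq_sum:
  assumes "finite A" "Poly_Mapping.keys v \<subseteq> A"
  shows "pi_op \<alpha> i v = (\<Sum>\<tau>\<in>A. cscale (Poly_Mapping.lookup v \<tau>) (pi_basis \<alpha> i \<tau>))"
  unfolding pi_op_def by (rule sum.mono_neutral_left) (use assms in \<open>auto simp: in_keys_iff\<close>)

lemma linear_pi_op: "Vector_Spaces.linear cscale cscale (pi_op \<alpha> i)"
proof (intro Vector_Spaces.linear_iff[THEN iffD2] conjI allI cvs.vector_space_axioms)
  fix v w :: "filling \<Rightarrow>\<^sub>0 complex" and c
  let ?A = "Poly_Mapping.keys v \<union> Poly_Mapping.keys w"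
  show "pi_op \<alpha> i (v + w) = pi_op \<alpha> i v + pi_op \<alpha> i w"
    using keys_add[of v w]
    by (simp add: pi_op_eq_sum[of ?A] lookup_add cvs.scale_left_distrib sum.distrib)
  show "pi_op \<alpha> i (cscale c v) = cscale c (pi_op \<alpha> i v)"
    using keys_cscale[of c v]
    by (simp add: pi_op_eq_sum[of "Poly_Mapping.keys v"] cvs.scale_sum_right)
qed

lemma basis_vec_nonzero [simp]: "basis_vec \<tau> \<noteq> 0"
  by (metis lookup_single_eq lookup_zero zero_neq_one)

text \<open>Reduces the module relations, and later the compatibility of the quotient map, to single
  tableaux.\<close>

lemma eq_on_span_basis_vec:
  assumes "Vector_Spaces.linear cscale cscale f" "Vector_Spaces.linear cscale cscale g"
    and "\<And>\<tau>. \<tau> \<in> S \<Longrightarrow> f (basis_vec \<tau>) = g (basis_vec \<tau>)" "v \<in> cvs.span (basis_vec ` S)"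
  shows "f v = g v"
  using cvs.linear_eq_on[OF assms(1,2,4)] assms(3) by blast

lemma pi_op_basis_vec [simp]: "pi_op \<alpha> i (basis_vec \<tau>) = pi_basis \<alpha> i \<tau>"
  by (simp add: pi_op_def)

lemma pi_op_zero [simp]: "pi_op \<alpha> i 0 = 0"
  by (simp add: pi_op_def)

lemma linear_map_on_linear:
  assumes "Vector_Spaces.linear cscale cscale f" "\<And>v. v \<in> V \<Longrightarrow> f v \<in> W"
  shows "linear_map_on V W f"
  using assms by (auto simp: linear_map_on_def Vector_Spaces.linear_iff)


section \<open>The 0-Hecke relations\<close>

text \<open>The move puts \<open>i\<close> strictly right of \<open>i + 1\<close>; hence a second
  application of the operator fixes the result.\<close>

lemma Des_swap_entries_self:
  assumes "\<tau> \<in> SRCT \<alpha>" "i \<in> Des \<alpha> \<tau>" "\<not> attacking \<alpha> \<tau> i"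
  shows "i \<notin> Des \<alpha> (swap_entries \<alpha> i \<tau>)"
  using assms(2,3) cell_of_swap_entries[OF assms, of i] cell_of_swap_entries[OF assms, of "i + 1"]
  by (auto simp: Des_def attacking_def)

lemma pi_op_idem:
  assumes "\<tau> \<in> SRCT \<alpha>"
  shows "pi_op \<alpha> i (pi_basis \<alpha> i \<tau>) = pi_basis \<alpha> i \<tau>"
  using assms Des_swap_entries_self by (auto simp: pi_basis_def)

text \<open>Distant indices involve disjoint pairs of entries, so a move of one pair leaves the
  cells of the other in place.\<close>

lemma pi_op_commute:
  assumes \<tau>: "\<tau> \<in> SRCT \<alpha>" and ij: "i + 1 < j \<or> j + 1 < i"
  shows "pi_op \<alpha> i (pi_basis \<alpha> j \<tau>) = pi_op \<alpha> j (pi_basis \<alpha> i \<tau>)"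
proof -
  \<comment> \<open>The second clause is limited to descents because \<open>cell_of\<close> is
    unspecified at numbers that are not entries.\<close>
  have same: "(a \<in> Des \<alpha> (swap_entries \<alpha> b \<tau>) \<longleftrightarrow> a \<in> Des \<alpha> \<tau>) \<and>
      (a \<in> Des \<alpha> \<tau> \<longrightarrow> attacking \<alpha> (swap_entries \<alpha> b \<tau>) a = attacking \<alpha> \<tau> a)"
    if "b \<in> Des \<alpha> \<tau>" "\<not> attacking \<alpha> \<tau> b" "a + 1 < b \<or> b + 1 < a" for a b
  proof (cases "a \<in> {1..<sum_list \<alpha>}")
    case True
    then have "cell_of \<alpha> (swap_entries \<alpha> b \<tau>) a = cell_of \<alpha> \<tau> a"
      "cell_of \<alpha> (swap_entries \<alpha> b \<tau>) (a + 1) = cell_of \<alpha> \<tau> (a + 1)"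
      using that(3) cell_of_swap_entries[OF \<tau> that(1,2)] by (auto simp: transpose_def)
    then show ?thesis
      by (simp add: Des_def attacking_def)
  qed (auto simp: Des_def)
  show ?thesis
    using same[of i j] same[of j i] ij swap_entries_commute[OF ij]
    by (auto simp: pi_basis_def)
qed

text \<open>Here \<open>p\<close> and \<open>q\<close> stand for the cells of \<open>i\<close> and \<open>i + 1\<close> in the tableau on which \<open>\<pi>\<^sub>i\<close> acts.\<close>

definition cells_fix :: "nat \<times> nat \<Rightarrow> nat \<times> nat \<Rightarrow> bool" where
  "cells_fix p q \<longleftrightarrow> snd q < snd p"

definition cells_kill :: "nat \<times> nat \<Rightarrow> nat \<times> nat \<Rightarrow> bool" where
  "cells_kill p q \<longleftrightarrow> snd p = snd q \<or> snd q = snd p + 1 \<and> fst p < fst q"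

definition cells_move :: "nat \<times> nat \<Rightarrow> nat \<times> nat \<Rightarrow> bool" where
  "cells_move p q \<longleftrightarrow> snd p < snd q \<and> \<not> (snd q = snd p + 1 \<and> fst p < fst q)"

lemma cells_cases:
  obtains (fixed) "cells_fix p q" | (killed) "cells_kill p q" | (moved) "cells_move p q"
  unfolding cells_fix_def cells_kill_def cells_move_def by linarith

lemma pi_basis_cells:
  assumes "i \<in> {1..<sum_list \<alpha>}"
  shows "cells_fix (cell_of \<alpha> \<tau> i) (cell_of \<alpha> \<tau> (i + 1)) \<Longrightarrow> pi_basis \<alpha> i \<tau> = basis_vec \<tau>"
    and "cells_kill (cell_of \<alpha> \<tau> i) (cell_of \<alpha> \<tau> (i + 1)) \<Longrightarrow> pi_basis \<alpha> i \<tau> = 0"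
    and "cells_move (cell_of \<alpha> \<tau> i) (cell_of \<alpha> \<tau> (i + 1)) \<Longrightarrow>
      pi_basis \<alpha> i \<tau> = basis_vec (swap_entries \<alpha> i \<tau>)"
  using assms
  by (auto simp: pi_basis_def Des_def attacking_def cells_fix_def cells_kill_def cells_move_def)

lemma cells_move_iff:
  assumes "i \<in> {1..<sum_list \<alpha>}"
  shows "cells_move (cell_of \<alpha> \<tau> i) (cell_of \<alpha> \<tau> (i + 1)) \<longleftrightarrow> i \<in> Des \<alpha> \<tau> \<and> \<not> attacking \<alpha> \<tau> i"
  using assms by (auto simp: Des_def attacking_def cells_move_def)

text \<open>Let \<open>p\<close>, \<open>q\<close>, \<open>s\<close> be the cells of
  \<open>i\<close>, \<open>i + 1\<close>, \<open>i + 2\<close>. Moves permute this triple, so the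
  outcome of both sides is governed by the pairs \<open>p q\<close>, \<open>q s\<close> and
  \<open>p s\<close>, through which the case split runs.\<close>

lemma pi_op_braid:
  assumes \<tau>: "\<tau> \<in> SRCT \<alpha>" and i: "i \<in> {1..<sum_list \<alpha>}" "i + 1 \<in> {1..<sum_list \<alpha>}"
  shows "pi_op \<alpha> i (pi_op \<alpha> (i + 1) (pi_basis \<alpha> i \<tau>)) =
    pi_op \<alpha> (i + 1) (pi_op \<alpha> i (pi_basis \<alpha> (i + 1) \<tau>))"
proof -
  define occ where "occ \<sigma> p q s \<longleftrightarrow> \<sigma> \<in> SRCT \<alpha> \<and> cell_of \<alpha> \<sigma> i = p \<and> cell_of \<alpha> \<sigma> (i + 1) = q \<and>
      cell_of \<alpha> \<sigma> (i + 2) = s" for \<sigma> p q s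
  let ?s1 = "swap_entries \<alpha> i" and ?s2 = "swap_entries \<alpha> (i + 1)"
  have i2: "i + 1 + 1 = i + 2"
    by simp
  note simps1 = pi_basis_cells[OF i(1)] and simps2 = pi_basis_cells[OF i(2), unfolded i2]
  have occ1: "occ (?s1 \<sigma>) q p s" if "occ \<sigma> p q s" "cells_move p q" for \<sigma> p q s
  proof -
    have \<sigma>: "\<sigma> \<in> SRCT \<alpha>" "i \<in> Des \<alpha> \<sigma>" "\<not> attacking \<alpha> \<sigma> i"
      using that cells_move_iff[OF i(1), of \<sigma>] by (auto simp: occ_def)
    then show ?thesis
      using that(1) i swap_entries_SRCT[OF \<sigma>] by (auto simp: occ_def cell_of_swap_entries[OF \<sigma>])
  qed
  have occ2: "occ (?s2 \<sigma>) p s q" if "occ \<sigma> p q s" "cells_move q s" for \<sigma> p q s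
  proof -
    have \<sigma>: "\<sigma> \<in> SRCT \<alpha>" "i + 1 \<in> Des \<alpha> \<sigma>" "\<not> attacking \<alpha> \<sigma> (i + 1)"
      using that cells_move_iff[OF i(2), of \<sigma>] by (auto simp: occ_def)
    then show ?thesis
      using that(1) i swap_entries_SRCT[OF \<sigma>] cell_of_swap_entries[OF \<sigma>]
      by (auto simp: occ_def transpose_def)
  qed
  \<comment> \<open>After a move the exchanged pair occurs in reverse order and is then
    fixed.\<close>
  have fix_move: "cells_fix q p" if "cells_move p q" for p q
    using that by (auto simp: cells_fix_def cells_move_def)
  have fix1: "pi_basis \<alpha> i \<sigma> = basis_vec \<sigma>" if "occ \<sigma> p q s" "cells_fix p q" for \<sigma> p q s
    using that simps1 by (simp add: occ_def)
  have kill1: "pi_basis \<alpha> i \<sigma> = 0" if "occ \<sigma> p q s" "cells_kill p q" for \<sigma> p q s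
    using that simps1 by (simp add: occ_def)
  have move1: "pi_basis \<alpha> i \<sigma> = basis_vec (?s1 \<sigma>)" if "occ \<sigma> p q s" "cells_move p q" for \<sigma> p q s
    using that simps1 by (simp add: occ_def)
  have fix2: "pi_basis \<alpha> (i + 1) \<sigma> = basis_vec \<sigma>" if "occ \<sigma> p q s" "cells_fix q s" for \<sigma> p q s
    using that simps2 by (simp add: occ_def)
  have kill2: "pi_basis \<alpha> (i + 1) \<sigma> = 0" if "occ \<sigma> p q s" "cells_kill q s" for \<sigma> p q s
    using that simps2 by (simp add: occ_def)
  have move2: "pi_basis \<alpha> (i + 1) \<sigma> = basis_vec (?s2 \<sigma>)" if "occ \<sigma> p q s" "cells_move q s" for \<sigma> p q s
    using that simps2 by (simp add: occ_def)
  note act = fix1 kill1 move1 fix2 kill2 move2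
  obtain p q s where occ: "occ \<tau> p q s"
    using \<tau> by (simp add: occ_def)
  note defs = cells_fix_def cells_kill_def cells_move_def
  show ?thesis
  proof (cases p q rule: cells_cases)
    case pq: fixed
    show ?thesis
    proof (cases q s rule: cells_cases)
      case qs: moved
      note t2 = occ2[OF occ qs]
      show ?thesis
      proof (cases p s rule: cells_cases)
        case ps: moved
        show ?thesis
          using act[OF occ] act[OF t2] act[OF occ1[OF t2 ps]] pq qs ps by simp
      qed (use act[OF occ] act[OF t2] pq qs fix_move in simp_all)
    qed (use act[OF occ] pq in simp_all)
  next
    case pq: killed
    show ?thesis
    proof (cases q s rule: cells_cases)
      case qs: moved
      note t2 = occ2[OF occ qs]
      show ?thesis
      proof (cases p s rule: cells_cases)
        \<comment> \<open>Impossible: passing through \<open>q\<close>, the cell \<open>s\<close> is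
          strictly right of \<open>p\<close>, while a fixed pair has it strictly left.\<close>
        case ps: fixed
        then show ?thesis
          using pq qs by (auto simp: defs)
      next
        case ps: moved
        show ?thesis
          using act[OF occ] act[OF t2] act[OF occ1[OF t2 ps]] pq qs ps by simp
      qed (use act[OF occ] act[OF t2] pq qs in simp_all)
    qed (use act[OF occ] pq in simp_all)
  next
    case pq: moved
    note t1 = occ1[OF occ pq]
    show ?thesis
    proof (cases q s rule: cells_cases)
      case qs: fixed
      show ?thesis
      proof (cases p s rule: cells_cases)
        case ps: moved
        show ?thesis
          using act[OF occ] act[OF t1] act[OF occ2[OF t1 ps]] pq qs ps by simp
      qed (use act[OF occ] act[OF t1] pq qs fix_move in simp_all)
    next
      case qs: killed
      show ?thesis
      proof (cases p s rule: cells_cases)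
        case ps: fixed
        then show ?thesis
          using pq qs by (auto simp: defs)
      next
        case ps: moved
        show ?thesis
          using act[OF occ] act[OF t1] act[OF occ2[OF t1 ps]] pq qs ps by simp
      qed (use act[OF occ] act[OF t1] pq qs in simp_all)
    next
      case qs: moved
      \<comment> \<open>The cell \<open>s\<close> is at least two columns right of \<open>p\<close>,
        which rules out the diagonal attack.\<close>
      have ps: "cells_move p s"
        using pq qs by (auto simp: defs)
      note t2 = occ2[OF occ qs] and t21 = occ2[OF t1 ps]
      note t12 = occ1[OF t2 ps]
      show ?thesis
        \<comment> \<open>All pairs move, so both sides are three successive interchanges.\<close>
        using act[OF occ] act[OF t1] act[OF t2] act[OF t21] act[OF t12] pq qs ps
          swap_entries_braid[of \<alpha> i \<tau>] by simp
    qed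
  qed
qed


section \<open>Filtration by tableaux\<close>

definition tableau_module :: "nat list \<Rightarrow> filling set \<Rightarrow> filling hmodule" where
  "tableau_module \<alpha> S = (cvs.span (basis_vec ` S), pi_op \<alpha>)"

text \<open>Closure under moves makes the span invariant, since the other two outcomes of an
  operator never leave it. It persists when a tableau of maximal weight is removed.\<close>

definition move_closed :: "nat list \<Rightarrow> filling set \<Rightarrow> bool" where
  "move_closed \<alpha> S \<longleftrightarrow> S \<subseteq> SRCT \<alpha> \<and>
     (\<forall>\<tau>\<in>S. \<forall>i\<in>Des \<alpha> \<tau>. \<not> attacking \<alpha> \<tau> i \<longrightarrow> swap_entries \<alpha> i \<tau> \<in> S)"

lemma move_closed_SRCT: "move_closed \<alpha> (SRCT \<alpha>)"
  by (simp add: move_closed_def swap_entries_SRCT)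

lemma pi_basis_in_span:
  assumes "move_closed \<alpha> S" "\<tau> \<in> S"
  shows "pi_basis \<alpha> i \<tau> \<in> cvs.span (basis_vec ` S)"
  using assms by (auto simp: pi_basis_def move_closed_def intro: cvs.span_base cvs.span_zero)

lemma pi_op_in_span:
  assumes "move_closed \<alpha> S" "v \<in> cvs.span (basis_vec ` S)"
  shows "pi_op \<alpha> i v \<in> cvs.span (basis_vec ` S)"
proof -
  have "pi_op \<alpha> i v \<in> cvs.span (pi_op \<alpha> i ` basis_vec ` S)"
    using cvs.linear_span_image[OF linear_pi_op, of \<alpha> i "basis_vec ` S"] assms(2) by blast
  also have "\<dots> \<subseteq> cvs.span (basis_vec ` S)"
    using pi_basis_in_span[OF assms(1)] by (intro cvs.span_minimal) auto
  finally show ?thesis .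
qed

lemma tableau_module_fd:
  assumes S: "move_closed \<alpha> S"
  shows "tableau_module \<alpha> S \<in> fd_hecke_modules (sum_list \<alpha>)"
proof -
  let ?V = "cvs.span (basis_vec ` S)"
  have SR: "S \<subseteq> SRCT \<alpha>"
    using S by (simp add: move_closed_def)
  note lin = linear_pi_op[of \<alpha>]
  note comp = Vector_Spaces.linear_compose[OF lin lin]
  note comp3 = Vector_Spaces.linear_compose[OF comp lin]
  have "hecke_module (sum_list \<alpha>) (?V, pi_op \<alpha>)"
    unfolding hecke_module_def prod.case
  proof (intro conjI ballI impI)
    show "linear_map_on ?V ?V (pi_op \<alpha> i)" for i
      using S by (intro linear_map_on_linear linear_pi_op pi_op_in_span)
    show "pi_op \<alpha> i (pi_op \<alpha> i v) = pi_op \<alpha> i v" if "v \<in> ?V" for i v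
      by (rule eq_on_span_basis_vec[OF comp lin _ that, unfolded o_apply])
        (use SR pi_op_idem in auto)
    show "pi_op \<alpha> i (pi_op \<alpha> (i + 1) (pi_op \<alpha> i v)) = pi_op \<alpha> (i + 1) (pi_op \<alpha> i (pi_op \<alpha> (i + 1) v))"
      if "i \<in> {1..<sum_list \<alpha>}" "i + 1 \<in> {1..<sum_list \<alpha>}" "v \<in> ?V" for i v
      by (rule eq_on_span_basis_vec[OF comp3 comp3 _ that(3), unfolded o_apply],
          unfold pi_op_basis_vec, rule pi_op_braid) (use SR that in auto)
    show "pi_op \<alpha> i (pi_op \<alpha> j v) = pi_op \<alpha> j (pi_op \<alpha> i v)"
      if "\<bar>int i - int j\<bar> \<ge> 2" "v \<in> ?V" for i j v
      by (rule eq_on_span_basis_vec[OF comp comp _ that(2), unfolded o_apply],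
          unfold pi_op_basis_vec, rule pi_op_commute) (use SR that(1) in auto)
  qed simp
  moreover have "finite S"
    using SR finite_SRCT finite_subset by blast
  ultimately show ?thesis
    by (auto simp: fd_hecke_modules_def tableau_module_def finite_dim_def)
qed

section \<open>Irreducible quotients\<close>

text \<open>On the line each operator is zero or the identity, and such operators satisfy all the
  relations.\<close>

lemma irreducible_module_fd: "irreducible_module \<beta> v \<in> fd_hecke_modules n"
  by (auto simp: irreducible_module_def fd_hecke_modules_def hecke_module_def finite_dim_def
      linear_map_on_def cvs.span_zero intro: exI[of _ "{v}"])

lemma Des_subset: "Des \<alpha> \<tau> \<subseteq> {1..<sum_list \<alpha>}"
  by (auto simp: Des_def)

text \<open>The quotient map \<open>g\<close> extracts the coefficient of \<tau>. A descent kills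
  \<tau> or moves it to a different tableau, so it acts as zero on the quotient; every other index
  fixes \<tau>.\<close>

lemma short_exact_remove:
  assumes S: "move_closed \<alpha> S" and S': "move_closed \<alpha> (S - {\<tau>})" and \<tau>: "\<tau> \<in> S"
  shows "short_exact (sum_list \<alpha>) (tableau_module \<alpha> (S - {\<tau>})) (tableau_module \<alpha> S)
    (irreducible_module (comp_tab \<alpha> \<tau>) (basis_vec \<tau>))"
proof -
  let ?n = "sum_list \<alpha>" and ?V = "cvs.span (basis_vec ` S)" and ?W = "cvs.span (basis_vec ` (S - {\<tau>}))"
  let ?F = "irreducible_module (comp_tab \<alpha> \<tau>) (basis_vec \<tau>)"
  define g where "g v = cscale (Poly_Mapping.lookup v \<tau>) (basis_vec \<tau>)" for v :: "filling \<Rightarrow>\<^sub>0 complex"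
  have comp_set: "comp_set (comp_tab \<alpha> \<tau>) = Des \<alpha> \<tau>"
    unfolding comp_tab_def by (rule comp_set_comp_of_set[OF Des_subset])
  have W: "v \<in> ?W \<longleftrightarrow> v \<in> ?V \<and> Poly_Mapping.lookup v \<tau> = 0" for v
    unfolding span_basis_vec by (auto simp: in_keys_iff)
  have lin_g: "Vector_Spaces.linear cscale cscale g"
    by (simp add: Vector_Spaces.linear_iff cvs.vector_space_axioms g_def lookup_add
        cvs.scale_left_distrib)
  have g_0: "g v = 0 \<longleftrightarrow> Poly_Mapping.lookup v \<tau> = 0" for v
    by (simp add: g_def)
  have "\<tau> \<in> SRCT \<alpha>"
    using S \<tau> by (auto simp: move_closed_def)
  \<comment> \<open>The weight drop shows that a move never returns the same tableau.\<close>
  then have swap_ne: "swap_entries \<alpha> i \<tau> \<noteq> \<tau>" if "i \<in> Des \<alpha> \<tau>" "\<not> attacking \<alpha> \<tau> i" for i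
    using col_weight_swap_entries[of \<tau> \<alpha> i] that by force
  have hom_g: "g (pi_op \<alpha> i v) = (if i \<in> Des \<alpha> \<tau> then 0 else g v)" if "v \<in> ?V" for i v
  proof (rule eq_on_span_basis_vec[OF _ _ _ that])
    show "Vector_Spaces.linear cscale cscale (\<lambda>v. g (pi_op \<alpha> i v))"
      using Vector_Spaces.linear_compose[OF linear_pi_op lin_g] by (simp add: o_def)
    show "Vector_Spaces.linear cscale cscale (\<lambda>v. if i \<in> Des \<alpha> \<tau> then 0 else g v)"
      using lin_g by (auto simp: Vector_Spaces.linear_iff)
    fix \<sigma> assume \<sigma>: "\<sigma> \<in> S"
    show "g (pi_op \<alpha> i (basis_vec \<sigma>)) = (if i \<in> Des \<alpha> \<tau> then 0 else g (basis_vec \<sigma>))"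
    proof (cases "\<sigma> = \<tau>")
      case True
      then show ?thesis
        using \<sigma> swap_ne by (auto simp: pi_basis_def g_def lookup_single when_def)
    next
      \<comment> \<open>Closure of \<open>S - {\<tau>}\<close> under moves keeps the images of the
        other tableaux free of \<tau>.\<close>
      case False
      then have "basis_vec \<sigma> \<in> ?W"
        using \<sigma> by (auto intro: cvs.span_base)
      moreover from this have "pi_op \<alpha> i (basis_vec \<sigma>) \<in> ?W"
        by (rule pi_op_in_span[OF S'])
      ultimately have "g (basis_vec \<sigma>) = 0" "g (pi_op \<alpha> i (basis_vec \<sigma>)) = 0"
        by (simp_all only: W g_0)
      then show ?thesis
        by simp
    qed
  qed
  \<comment> \<open>The injection is the inclusion, whose image is the kernel of \<open>g\<close> by
    \<open>W\<close> and \<open>g_0\<close>.\<close>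
  have "linear_map_on ?W ?V id"
    using W by (auto simp: linear_map_on_def)
  then have "hecke_hom ?n (tableau_module \<alpha> (S - {\<tau>})) (tableau_module \<alpha> S) id"
    by (simp add: hecke_hom_def tableau_module_def)
  moreover have "linear_map_on ?V (cvs.span {basis_vec \<tau>}) g"
    using lin_g by (intro linear_map_on_linear) (auto simp: g_def intro: cvs.span_scale cvs.span_base)
  then have "hecke_hom ?n (tableau_module \<alpha> S) ?F g"
    using hom_g by (simp add: hecke_hom_def tableau_module_def irreducible_module_def comp_set)
  moreover have "g ` ?V = cvs.span {basis_vec \<tau>}"
  proof -
    have "g (cscale c (basis_vec \<tau>)) = cscale c (basis_vec \<tau>)" for c
      by (simp add: g_def)
    moreover have "cscale c (basis_vec \<tau>) \<in> ?V" for c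
      using \<tau> by (intro cvs.span_scale cvs.span_base) auto
    ultimately have "range (\<lambda>c. cscale c (basis_vec \<tau>)) \<subseteq> g ` ?V"
      by (metis image_eqI image_subsetI)
    then show ?thesis
      by (auto simp: cvs.span_singleton g_def)
  qed
  ultimately show ?thesis
    unfolding short_exact_def
    by (intro exI[of _ id] exI[of _ g])
      (use W g_0 in \<open>auto simp: tableau_module_def irreducible_module_def\<close>)
qed


section \<open>The characteristic\<close>

text \<open>The element \<open>M - M' - M''\<close> lies in the relation subgroup, so the class of
  \<open>M\<close> is the product of the other two classes, and \<open>ch\<close> is a homomorphism.
  Evaluation at a monomial \<open>m\<close> turns this into a sum of integers.\<close>

lemma ch_short_exact:
  fixes ch :: "('b hmodule \<Rightarrow>\<^sub>0 int) set \<Rightarrow> power_series"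
  assumes ch: "quasisymmetric_characteristic n ch"
    and fd: "M \<in> fd_hecke_modules n" "M' \<in> fd_hecke_modules n" "M'' \<in> fd_hecke_modules n"
    and ex: "short_exact n M' M M''"
  shows "ch (module_class n M) m = ch (module_class n M') m + ch (module_class n M'') m"
proof -
  define G where "G = free_Abelian_group (fd_hecke_modules n :: 'b hmodule set)"
  define H where "H = (relation_subgroup n :: ('b hmodule \<Rightarrow>\<^sub>0 int) set)"
  interpret comm_group G
    unfolding G_def by (rule abelian_free_Abelian_group)
  have rel: "exact_relations n \<subseteq> carrier G"
    unfolding exact_relations_def G_def
    by (auto simp: carrier_free_Abelian_group_iff dest!: keys_diff[THEN subsetD])
  then have sub: "subgroup H G"
    unfolding H_def relation_subgroup_def G_def[symmetric] by (rule generate_is_subgroup)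
  then interpret H: normal H G
    by (rule subgroup_imp_normal)
  have frag: "frag_of N \<in> carrier G" if "N \<in> fd_hecke_modules n" for N :: "'b hmodule"
    using that by (simp add: G_def)
  let ?d = "frag_of M - frag_of M' - frag_of M''" and ?x = "frag_of M' \<otimes>\<^bsub>G\<^esub> frag_of M''"
  have d: "?d \<in> H"
    unfolding H_def relation_subgroup_def using fd ex
    by (intro generate.incl) (unfold exact_relations_def, blast)
  \<comment> \<open>As \<open>?d\<close> lies in \<open>H\<close>, its coset is \<open>H\<close>
    itself and can be inserted.\<close>
  have "H #>\<^bsub>G\<^esub> ?x = (H #>\<^bsub>G\<^esub> ?d) #>\<^bsub>G\<^esub> ?x"
    using coset_join2[OF H.mem_carrier[OF d] sub d] by simp
  also have "\<dots> = H #>\<^bsub>G\<^esub> (?d \<otimes>\<^bsub>G\<^esub> ?x)"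
    by (intro coset_mult_assoc H.subset H.mem_carrier[OF d] m_closed frag fd)
  \<comment> \<open>The operation of the free abelian group is addition, so \<open>?d\<close> and
    \<open>?x\<close> combine to \<open>frag_of M\<close>.\<close>
  also have "\<dots> = H #>\<^bsub>G\<^esub> frag_of M"
    by (simp add: G_def)
  finally have "H #>\<^bsub>G\<^esub> frag_of M = (H #>\<^bsub>G\<^esub> frag_of M') <#>\<^bsub>G\<^esub> (H #>\<^bsub>G\<^esub> frag_of M'')"
    using H.rcos_sum frag fd by simp
  then have "module_class n M = module_class n M' \<otimes>\<^bsub>grothendieck_group n\<^esub> module_class n M''"
    by (simp add: module_class_def grothendieck_group_def FactGroup_def flip: G_def H_def)
  moreover have "module_class n N \<in> carrier (grothendieck_group n)" if "N \<in> fd_hecke_modules n" for N :: "'b hmodule"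
    using frag[OF that] H.subset rcosetsI
    by (simp add: module_class_def grothendieck_group_def FactGroup_def flip: G_def H_def)
  moreover have "ch \<in> hom (grothendieck_group n) QSym_group"
    using ch by (simp add: quasisymmetric_characteristic_def)
  ultimately show ?thesis
    using fd by (simp add: hom_mult QSym_group_def)
qed

lemma ch_tableau_module:
  assumes ch: "quasisymmetric_characteristic (sum_list \<alpha>) ch" and S: "move_closed \<alpha> S"
  shows "ch (module_class (sum_list \<alpha>) (tableau_module \<alpha> S)) m =
    (\<Sum>\<tau>\<in>S. fundamental_qsym (comp_tab \<alpha> \<tau>) m)"
proof -
  let ?ch = "\<lambda>M. ch (module_class (sum_list \<alpha>) M) m"
  have "finite S"
    using S finite_SRCT finite_subset by (auto simp: move_closed_def)
  then show ?thesis
    using S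
  proof (induction S rule: finite_psubset_induct)
    case (psubset S)
    show ?case
    proof (cases "S = {}")
      case True
      let ?Z = "tableau_module \<alpha> {}"
      \<comment> \<open>The zero module is an extension of itself by itself, which forces its value
        \<open>x\<close> to satisfy \<open>x = x + x\<close>.\<close>
      have "hecke_hom (sum_list \<alpha>) ?Z ?Z id"
        by (simp add: hecke_hom_def linear_map_on_def tableau_module_def)
      then have "short_exact (sum_list \<alpha>) ?Z ?Z ?Z"
        unfolding short_exact_def
        by (intro exI[of _ id]) (auto simp: tableau_module_def)
      then have "?ch ?Z = ?ch ?Z + ?ch ?Z"
        using psubset.prems True by (intro ch_short_exact[OF ch] tableau_module_fd) auto
      then show ?thesis
        using True by simp
    next
      case False
      obtain \<tau> where \<tau>: "\<tau> \<in> S" and max: "\<And>\<sigma>. \<sigma> \<in> S \<Longrightarrow> col_weight \<alpha> \<sigma> \<le> col_weight \<alpha> \<tau>"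
      proof -
        have "Max (col_weight \<alpha> ` S) \<in> col_weight \<alpha> ` S"
          using psubset.hyps False by (intro Max_in) auto
        then obtain \<tau> where "\<tau> \<in> S" "Max (col_weight \<alpha> ` S) = col_weight \<alpha> \<tau>"
          by blast
        moreover have "col_weight \<alpha> \<sigma> \<le> Max (col_weight \<alpha> ` S)" if "\<sigma> \<in> S" for \<sigma>
          using psubset.hyps that by (intro Max_ge) auto
        ultimately show ?thesis
          using that by simp
      qed
      \<comment> \<open>A move ends strictly below its source, whose weight is at most that of
        \<tau>.\<close>
      have "swap_entries \<alpha> i \<sigma> \<noteq> \<tau>"
        if "\<sigma> \<in> S" "i \<in> Des \<alpha> \<sigma>" "\<not> attacking \<alpha> \<sigma> i" for i \<sigma>
      proof -
        have "\<sigma> \<in> SRCT \<alpha>"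
          using psubset.prems that(1) by (auto simp: move_closed_def)
        then have "col_weight \<alpha> (swap_entries \<alpha> i \<sigma>) < col_weight \<alpha> \<tau>"
          using col_weight_swap_entries that(2,3) max[OF that(1)] by (meson order_less_le_trans)
        then show ?thesis
          by blast
      qed
      then have S': "move_closed \<alpha> (S - {\<tau>})"
        using psubset.prems unfolding move_closed_def by auto
      let ?F = "irreducible_module (comp_tab \<alpha> \<tau>) (basis_vec \<tau>)"
      have "?ch (tableau_module \<alpha> S) = ?ch (tableau_module \<alpha> (S - {\<tau>})) + ?ch ?F"
        using short_exact_remove[OF psubset.prems S' \<tau>] psubset.prems S'
        by (intro ch_short_exact[OF ch] tableau_module_fd irreducible_module_fd)
      also have "?ch (tableau_module \<alpha> (S - {\<tau>})) = (\<Sum>\<sigma>\<in>S - {\<tau>}. fundamental_qsym (comp_tab \<alpha> \<sigma>) m)"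
        using \<tau> S' by (intro psubset.IH) auto
      \<comment> \<open>Descents lie in \<open>{1..<sum_list \<alpha>}\<close>, so
        \<open>comp_tab\<close> yields a composition and the prescribed value of \<open>ch\<close>
        applies.\<close>
      also have "?ch ?F = fundamental_qsym (comp_tab \<alpha> \<tau>) m"
        using ch is_composition_comp_of_set[OF Des_subset]
        unfolding quasisymmetric_characteristic_def comp_tab_def by simp
      finally show ?thesis
        using \<tau> psubset.hyps by (simp add: sum.remove)
    qed
  qed
qed

theorem theorem5p2:
  fixes n :: nat and \<alpha> :: "nat list" and r :: "filling rel" and \<tau>\<^sub>1 :: filling
    and ch :: "(filling hmodule \<Rightarrow>\<^sub>0 int) set \<Rightarrow> power_series"
  assumes "is_composition n \<alpha>"
    and "linear_order_on (SRCT \<alpha>) r"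
    and "srct_order \<alpha> \<subseteq> r"
    and "\<tau>\<^sub>1 \<in> SRCT \<alpha>"
    and "\<forall>\<tau>\<in>SRCT \<alpha>. (\<tau>, \<tau>\<^sub>1) \<in> r \<longrightarrow> \<tau> = \<tau>\<^sub>1"
    and "quasisymmetric_characteristic n ch"
  shows "srct_module \<alpha> r \<tau>\<^sub>1 \<in> fd_hecke_modules n \<and>
         ch (module_class n (srct_module \<alpha> r \<tau>\<^sub>1)) = schur_qsym \<alpha>"
proof -
  have n: "n = sum_list \<alpha>"
    using assms(1) by (simp add: is_composition_def)
  \<comment> \<open>A minimal element of a total order is least, so the spanning set consists of all
    tableaux of the shape.\<close>
  have "(\<tau>\<^sub>1, \<tau>) \<in> r" if "\<tau> \<in> SRCT \<alpha>" for \<tau>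
    using assms(2,4,5) that
    by (metis linear_order_on_def partial_order_on_def preorder_on_def refl_onD total_on_def)
  then have "{basis_vec \<tau> | \<tau>. \<tau> \<in> SRCT \<alpha> \<and> (\<tau>\<^sub>1, \<tau>) \<in> r} = basis_vec ` SRCT \<alpha>"
    by auto
  then have "srct_module \<alpha> r \<tau>\<^sub>1 = tableau_module \<alpha> (SRCT \<alpha>)"
    by (simp add: srct_module_def tableau_module_def)
  then show ?thesis
    using tableau_module_fd[OF move_closed_SRCT] ch_tableau_module[OF _ move_closed_SRCT] assms(6)
    unfolding n by (auto simp: schur_qsym_def fun_eq_iff)
qed

end
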